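(* There is a polynomial-time reduction mapping NAE-E4-SAT instances $\phi$ to NAE-E3-SAT instances $\phi'$ such that $\mathrm{val}(\phi')=\tfrac12(1+\mathrm{val}(\phi))$.
   Context: An NAE-E$k$-SAT formula consists of Boolean variables and constraints, each a function of exactly $k$ distinct literals (variables or their negations), satisfied by an assignment iff its $k$ literals do not all evaluate to the same value. $\mathrm{val}(\phi)$ is the maximum, over all assignments to the variables, of the fraction of constraints of $\phi$ that are satisfied. *)

theory Defs
  imports Complex_Main "HOL-Computational_Algebra.Polynomial"
begin

section \<open>NAE formulas and their value\<close>

datatype literal = Pos nat | Neg nat

type_synonym formula = "literal list list"

fun lit_true :: "(nat \<Rightarrow> bool) \<Rightarrow> literal \<Rightarrow> bool" where
  "lit_true a (Pos x) \<longleftrightarrow> a x"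
| "lit_true a (Neg x) \<longleftrightarrow> \<not> a x"

definition nae_sat :: "(nat \<Rightarrow> bool) \<Rightarrow> literal list \<Rightarrow> bool" where
  "nae_sat a c \<longleftrightarrow> \<not> (\<forall>l\<in>set c. \<forall>l'\<in>set c. lit_true a l = lit_true a l')"

text \<open>Constraints may be repeated, and a constraint may contain both a variable and its
  negation, as these are distinct literals. There is at least one constraint: otherwise the
  fraction of satisfied constraints is undefined.\<close>

definition nae_formulas :: "nat \<Rightarrow> formula set" where
  "nae_formulas k = {\<phi>. \<phi> \<noteq> [] \<and> (\<forall>c\<in>set \<phi>. length c = k \<and> distinct c)}"

definition sat_fraction :: "(nat \<Rightarrow> bool) \<Rightarrow> formula \<Rightarrow> real" where
  "sat_fraction a \<phi> = real (length (filter (nae_sat a) \<phi>)) / real (length \<phi>)"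

text \<open>The maximum is over a finite nonempty set, since each fraction is one of
  \<open>0/m, ..., m/m\<close> with \<open>m\<close> the number of constraints.\<close>

definition val :: "formula \<Rightarrow> real" where
  "val \<phi> = Max (range (\<lambda>a. sat_fraction a \<phi>))"

section \<open>Deterministic multi-tape Turing machines\<close>

text \<open>States are \<open>0, ..., num_states - 1\<close> together with the halting state \<open>num_states\<close>; the
  initial state is \<open>0\<close>. The tape symbols are \<open>0, ..., num_symbols - 1\<close>, with \<open>0\<close> the blank.
  Tapes are infinite in both directions. Tape \<open>0\<close> initially holds the input, tape \<open>1\<close> finally
  holds the output. The values of \<open>trans\<close> outside the ranges considered in \<open>wf_tm\<close> are
  irrelevant, so a well-formed machine is a finite object.\<close>

datatype move = MLeft | MStay | MRight

record tm =
  num_tapes :: nat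
  num_states :: nat
  num_symbols :: nat
  trans :: "nat \<Rightarrow> nat list \<Rightarrow> nat \<times> (nat \<times> move) list"

definition wf_tm :: "tm \<Rightarrow> bool" where
  "wf_tm M \<longleftrightarrow> 2 \<le> num_tapes M \<and> 0 < num_symbols M \<and>
     (\<forall>q<num_states M. \<forall>ss. length ss = num_tapes M \<and> set ss \<subseteq> {..<num_symbols M} \<longrightarrow>
        fst (trans M q ss) \<le> num_states M \<and>
        length (snd (trans M q ss)) = num_tapes M \<and>
        fst ` set (snd (trans M q ss)) \<subseteq> {..<num_symbols M})"

text \<open>A tape is its contents together with the head position.\<close>

type_synonym tape = "(int \<Rightarrow> nat) \<times> int"

type_synonym config = "nat \<times> tape list"

fun move_head :: "move \<Rightarrow> int \<Rightarrow> int" where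
  "move_head MLeft i = i - 1"
| "move_head MStay i = i"
| "move_head MRight i = i + 1"

fun act :: "nat \<times> move \<Rightarrow> tape \<Rightarrow> tape" where
  "act (s, m) (t, i) = (t(i := s), move_head m i)"

definition step :: "tm \<Rightarrow> config \<Rightarrow> config" where
  "step M c = (case c of (q, ts) \<Rightarrow>
     if q < num_states M
     then (case trans M q (map (\<lambda>(t, i). t i) ts) of (q', acts) \<Rightarrow> (q', map2 act acts ts))
     else (q, ts))"

definition contents :: "nat list \<Rightarrow> int \<Rightarrow> nat" where
  "contents w i = (if 0 \<le> i \<and> i < int (length w) then w ! nat i else 0)"

definition init_config :: "tm \<Rightarrow> nat list \<Rightarrow> config" where
  "init_config M w = (0, (contents w, 0) # replicate (num_tapes M - 1) (contents [], 0))"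

definition outputs_within :: "tm \<Rightarrow> nat list \<Rightarrow> nat list \<Rightarrow> nat \<Rightarrow> bool" where
  "outputs_within M w v T \<longleftrightarrow> (\<exists>t\<le>T. case (step M ^^ t) (init_config M w) of (q, ts) \<Rightarrow>
     q = num_states M \<and> fst (ts ! 1) = contents v)"

text \<open>Polynomial-time computability of a map on the instances in \<open>A\<close>, relative to encodings
  of inputs and outputs as words of nonblank symbols. Time is measured in the length of the
  encoded input.\<close>

definition polytime_on ::
  "'a set \<Rightarrow> ('a \<Rightarrow> nat list) \<Rightarrow> ('b \<Rightarrow> nat list) \<Rightarrow> ('a \<Rightarrow> 'b) \<Rightarrow> bool" where
  "polytime_on A enc enc' f \<longleftrightarrow> (\<exists>M (p :: nat poly). wf_tm M \<and>
     (\<forall>x\<in>A. set (enc x) \<subseteq> {0<..<num_symbols M} \<and>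
            set (enc' (f x)) \<subseteq> {0<..<num_symbols M} \<and>
            outputs_within M (enc x) (enc' (f x)) (poly p (length (enc x)))))"

section \<open>Encoding of formulas\<close>

text \<open>Variable indices are written in binary, least significant bit first and without leading
  zeros (so \<open>0\<close> is the empty word), with symbol \<open>1\<close> for the bit zero and \<open>2\<close> for the bit one.
  Each literal starts with its sign, \<open>3\<close> or \<open>4\<close>, and each constraint ends with \<open>5\<close>.\<close>

fun enc_nat :: "nat \<Rightarrow> nat list" where
  "enc_nat n = (if n = 0 then [] else (if odd n then 2 else 1) # enc_nat (n div 2))"

declare enc_nat.simps [simp del]

fun enc_lit :: "literal \<Rightarrow> nat list" where
  "enc_lit (Pos x) = 3 # enc_nat x"
| "enc_lit (Neg x) = 4 # enc_nat x"

definition enc_constraint :: "literal list \<Rightarrow> nat list" where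
  "enc_constraint c = concat (map enc_lit c) @ [5]"

definition enc_formula :: "formula \<Rightarrow> nat list" where
  "enc_formula \<phi> = concat (map enc_constraint \<phi>)"


lemma enc_nat_inj: "enc_nat m = enc_nat n \<Longrightarrow> m = n"
proof (induction m arbitrary: n rule: less_induct)
  case (less m)
  show ?case
  proof (cases "m = 0 \<or> n = 0")
    case True
    with less.prems show ?thesis by (auto simp: enc_nat.simps[of m] enc_nat.simps[of n] split: if_splits)
  next
    case False
    with less.prems have "odd m = odd n" "enc_nat (m div 2) = enc_nat (n div 2)"
      by (auto simp: enc_nat.simps[of m] enc_nat.simps[of n] split: if_splits)
    moreover have "m div 2 < m" using False by simp
    ultimately have "m div 2 = n div 2" "odd m = odd n" using less.IH by blast+
    then show ?thesis by presburger
  qed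
qed

lemma enc_nat_less: "x \<in> set (enc_nat n) \<Longrightarrow> x < 3"
  by (induction n rule: enc_nat.induct) (subst (asm) (2) enc_nat.simps, auto split: if_splits)

lemma enc_nat_append_cancel:
  assumes "enc_nat m @ r = enc_nat n @ s" "r \<noteq> []" "s \<noteq> []" "3 \<le> hd r" "3 \<le> hd s"
  shows "m = n \<and> r = s"
proof -
  have *: "takeWhile (\<lambda>x. x < 3) (enc_nat k @ t) = enc_nat k" if "t \<noteq> []" "3 \<le> hd t" for k t
    using that by (cases t) (auto simp: takeWhile_tail enc_nat_less)
  have "enc_nat m = enc_nat n"
    using *[of r m] *[of s n] assms by simp
  with assms(1) show ?thesis using enc_nat_inj by simp
qed

lemma enc_constraint_Cons: "enc_constraint (l # c) = enc_lit l @ enc_constraint c"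
  by (simp add: enc_constraint_def)

lemma enc_constraint_hd: "enc_constraint c \<noteq> [] \<and> 3 \<le> hd (enc_constraint c @ r)"
proof (cases c)
  case (Cons l c')
  then show ?thesis by (cases l) (auto simp: enc_constraint_def)
qed (simp add: enc_constraint_def)

lemma enc_constraint_append_cancel:
  "enc_constraint c @ r = enc_constraint d @ s \<Longrightarrow> c = d \<and> r = s"
proof (induction c arbitrary: d)
  case Nil
  then show ?case
  proof (cases d)
    case (Cons l d')
    with Nil show ?thesis by (cases l) (auto simp: enc_constraint_def)
  qed (auto simp: enc_constraint_def)
next
  case (Cons l c)
  show ?case
  proof (cases d)
    case Nil
    with Cons.prems show ?thesis by (cases l) (auto simp: enc_constraint_def)
  next
    case (Cons k d')
    have "l = k \<and> enc_constraint c @ r = enc_constraint d' @ s"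
      using Cons.prems enc_constraint_hd[of c r] enc_constraint_hd[of d' s] Cons
      by (cases l; cases k)
        (auto simp: enc_constraint_Cons dest!: enc_nat_append_cancel)
    with Cons.IH Cons show ?thesis by blast
  qed
qed

lemma inj_enc_formula: "inj enc_formula"
proof (rule injI)
  show "\<phi> = \<psi>" if "enc_formula \<phi> = enc_formula \<psi>" for \<phi> \<psi>
    using that
  proof (induction \<phi> arbitrary: \<psi>)
    case Nil
    then show ?case by (cases \<psi>) (auto simp: enc_formula_def enc_constraint_def)
  next
    case (Cons c \<phi>)
    show ?case
    proof (cases \<psi>)
      case Nil
      with Cons.prems show ?thesis by (auto simp: enc_formula_def enc_constraint_def)
    next
      case (Cons d \<psi>')
      with Cons.prems have "enc_constraint c @ enc_formula \<phi> = enc_constraint d @ enc_formula \<psi>'"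
        by (simp add: enc_formula_def)
      then show ?thesis using enc_constraint_append_cancel Cons.IH Cons by blast
    qed
  qed
qed

end

theory Submission
  imports Defs
begin

text \<open>A constraint on \<open>a, b, c, d\<close> becomes the two constraints on \<open>y, a, b\<close> and on
  \<open>\<not>y, c, d\<close> with a fresh variable \<open>y\<close>. If the old constraint is satisfied, then \<open>y\<close> can be
  chosen to satisfy both new ones; otherwise exactly one of them holds, whatever \<open>y\<close> is.

  The variable names are chosen so that a Turing machine can write them while it scans the input
  once: an old variable \<open>x\<close> becomes \<open>2 * x + 1\<close>, whose code is that of \<open>x\<close> with one symbol put in
  front, and the fresh variable of the \<open>i\<close>-th constraint is \<open>2 ^ (i + 1)\<close>, whose code is a unary
  counter followed by one symbol.\<close>

section \<open>The reduction\<close>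

fun lift_lit :: "literal \<Rightarrow> literal" where
  "lift_lit (Pos x) = Pos (2 * x + 1)"
| "lift_lit (Neg x) = Neg (2 * x + 1)"

fun split_from :: "nat \<Rightarrow> formula \<Rightarrow> formula" where
  "split_from n [] = []"
| "split_from n (c # \<phi>) =
     [Pos (2 ^ Suc n), lift_lit (c ! 0), lift_lit (c ! 1)] #
     [Neg (2 ^ Suc n), lift_lit (c ! 2), lift_lit (c ! 3)] # split_from (Suc n) \<phi>"

lemma length_split_from [simp]: "length (split_from n \<phi>) = 2 * length \<phi>"
  by (induction \<phi> arbitrary: n) auto

lemma length_4_conv: "length c = 4 \<longleftrightarrow> (\<exists>l1 l2 l3 l4. c = [l1, l2, l3, l4])"
  by (auto simp: numeral_eq_Suc length_Suc_conv)

lemma lift_lit_eq_iff [simp]: "lift_lit l = lift_lit l' \<longleftrightarrow> l = l'"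
  by (cases l; cases l') auto

text \<open>Parity separates the two kinds of names: lifted variables are odd, fresh ones
  even.\<close>

lemma lift_lit_neq_fresh: "lift_lit l \<noteq> Pos (2 ^ Suc n)" "lift_lit l \<noteq> Neg (2 ^ Suc n)"
proof -
  have "2 * x + 1 \<noteq> (2::nat) ^ Suc n" for x by (metis even_mult_iff even_plus_one_iff power_Suc dvd_refl)
  then show "lift_lit l \<noteq> Pos (2 ^ Suc n)" "lift_lit l \<noteq> Neg (2 ^ Suc n)" by (cases l; simp)+
qed

lemma split_from_wf:
  assumes "\<forall>c\<in>set \<phi>. length c = 4 \<and> distinct c"
  shows "\<forall>c\<in>set (split_from n \<phi>). length c = 3 \<and> distinct c"
  using assms
proof (induction \<phi> arbitrary: n)
  case (Cons c \<phi>)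
  then obtain l1 l2 l3 l4 where "c = [l1, l2, l3, l4]" by (auto simp: length_4_conv)
  with Cons show ?case
    using lift_lit_neq_fresh[of _ n, symmetric] by auto
qed simp

lemma split_from_in_nae_formulas:
  assumes "\<phi> \<in> nae_formulas 4"
  shows "split_from n \<phi> \<in> nae_formulas 3"
proof -
  have "split_from n \<phi> \<noteq> []" using assms by (cases \<phi>) (auto simp: nae_formulas_def)
  with assms show ?thesis using split_from_wf by (auto simp: nae_formulas_def)
qed

section \<open>The value\<close>

definition num_sat :: "(nat \<Rightarrow> bool) \<Rightarrow> formula \<Rightarrow> nat" where
  "num_sat a \<phi> = length (filter (nae_sat a) \<phi>)"

lemma num_sat_simps [simp]:
  "num_sat a [] = 0"
  "num_sat a (c # \<phi>) = of_bool (nae_sat a c) + num_sat a \<phi>"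
  by (simp_all add: num_sat_def)

lemma finite_sat_fractions: "finite (range (\<lambda>a. sat_fraction a \<phi>))"
proof (rule finite_subset)
  show "range (\<lambda>a. sat_fraction a \<phi>) \<subseteq> (\<lambda>i. real i / real (length \<phi>)) ` {..length \<phi>}"
    by (auto simp: sat_fraction_def)
qed simp

lemma sat_fraction_le_val: "sat_fraction a \<phi> \<le> val \<phi>"
  unfolding val_def by (rule Max_ge[OF finite_sat_fractions]) simp

lemma val_attained: obtains a where "sat_fraction a \<phi> = val \<phi>"
proof -
  have "val \<phi> \<in> range (\<lambda>a. sat_fraction a \<phi>)"
    unfolding val_def by (rule Max_in[OF finite_sat_fractions]) simp
  then show ?thesis using that by auto
qed

lemma lit_true_lift_lit [simp]: "lit_true a (lift_lit l) = lit_true (\<lambda>x. a (2 * x + 1)) l"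
  by (cases l) auto

text \<open>If the four literals of \<open>c\<close> share a value, then the fresh variable or its
  negation has that value too and violates its constraint. So a violated \<open>c\<close> yields at
  most one satisfied constraint, any other at most two.\<close>

lemma num_sat_split_from_le:
  assumes "\<forall>c\<in>set \<phi>. length c = 4"
  shows "num_sat a (split_from n \<phi>) \<le> length \<phi> + num_sat (\<lambda>x. a (2 * x + 1)) \<phi>"
  using assms
proof (induction \<phi> arbitrary: n)
  case (Cons c \<phi>)
  then obtain l1 l2 l3 l4 where c: "c = [l1, l2, l3, l4]" by (auto simp: length_4_conv)
  have "num_sat a (split_from (Suc n) \<phi>) \<le> length \<phi> + num_sat (\<lambda>x. a (2 * x + 1)) \<phi>"
    using Cons by simp
  then show ?case by (auto simp: c nae_sat_def simp del: power_Suc)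
qed simp

text \<open>If the first two literals agree, only the opposite value saves the first new constraint;
  the negated fresh literal then equals them, so the second one fails only if all four agree. If
  they differ, the first is safe and this choice makes the negated fresh literal differ from the
  third literal.\<close>

definition fresh_value :: "(nat \<Rightarrow> bool) \<Rightarrow> literal list \<Rightarrow> bool" where
  "fresh_value b c =
     (if lit_true b (c ! 0) = lit_true b (c ! 1) then \<not> lit_true b (c ! 0) else lit_true b (c ! 2))"

lemma num_sat_split_from_eq:
  assumes "\<forall>c\<in>set \<phi>. length c = 4"
    and "\<And>x. a (2 * x + 1) = b x"
    and "\<And>i. i < length \<phi> \<Longrightarrow> a (2 ^ Suc (n + i)) = fresh_value b (\<phi> ! i)"
  shows "num_sat a (split_from n \<phi>) = length \<phi> + num_sat b \<phi>"
  using assms(1,3)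
proof (induction \<phi> arbitrary: n)
  case (Cons c \<phi>)
  then obtain l1 l2 l3 l4 where c: "c = [l1, l2, l3, l4]" by (auto simp: length_4_conv)
  have b: "lit_true a (lift_lit l) = lit_true b l" for l
    using assms(2) by (cases l) auto
  have y: "a (2 ^ Suc n) = fresh_value b c" using Cons.prems(2)[of 0] by simp
  have "num_sat a (split_from (Suc n) \<phi>) = length \<phi> + num_sat b \<phi>"
  proof (rule Cons.IH)
    show "a (2 ^ Suc (Suc n + i)) = fresh_value b (\<phi> ! i)" if "i < length \<phi>" for i
      using Cons.prems(2)[of "Suc i"] that by simp
  qed (use Cons.prems in simp)
  then show ?case
    by (auto simp: c y b nae_sat_def fresh_value_def simp del: power_Suc lit_true_lift_lit)
qed simp

lemma num_sat_split_from_attained: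
  assumes "\<forall>c\<in>set \<phi>. length c = 4"
  obtains a where "num_sat a (split_from 0 \<phi>) = length \<phi> + num_sat b \<phi>"
proof -
  \<comment> \<open>Distinct constraints have distinct fresh variables, so \<open>THE\<close>
    recovers the index; the value at even numbers that are no such power never matters.\<close>
  define a where "a v = (if odd v then b (v div 2)
    else fresh_value b (\<phi> ! (THE i. v = 2 ^ Suc i)))" for v :: nat
  have "num_sat a (split_from 0 \<phi>) = length \<phi> + num_sat b \<phi>"
  proof (rule num_sat_split_from_eq[OF assms])
    fix i
    have "(THE j. (2::nat) ^ Suc i = 2 ^ Suc j) = i" by (rule the_equality) auto
    then show "a (2 ^ Suc (0 + i)) = fresh_value b (\<phi> ! i)" by (simp add: a_def)
  qed (simp add: a_def)
  then show ?thesis using that by blast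
qed

lemma val_split_from:
  assumes "\<phi> \<in> nae_formulas 4"
  shows "val (split_from 0 \<phi>) = 1 / 2 * (1 + val \<phi>)"
proof -
  have len: "\<forall>c\<in>set \<phi>. length c = 4" and pos: "real (length \<phi>) > 0"
    using assms by (auto simp: nae_formulas_def)
  have frac: "sat_fraction a \<psi> = real (num_sat a \<psi>) / real (length \<psi>)" for a \<psi>
    by (simp add: sat_fraction_def num_sat_def)
  show ?thesis
  proof (rule antisym)
    obtain a where a: "sat_fraction a (split_from 0 \<phi>) = val (split_from 0 \<phi>)"
      using val_attained .
    have "real (num_sat a (split_from 0 \<phi>)) \<le>
        real (length \<phi>) + real (num_sat (\<lambda>x. a (2 * x + 1)) \<phi>)"
      using num_sat_split_from_le[OF len, of a 0] by linarith
    then have "sat_fraction a (split_from 0 \<phi>) \<le> 1 / 2 * (1 + sat_fraction (\<lambda>x. a (2 * x + 1)) \<phi>)"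
      using pos by (simp add: frac field_simps)
    also have "\<dots> \<le> 1 / 2 * (1 + val \<phi>)" using sat_fraction_le_val by simp
    finally show "val (split_from 0 \<phi>) \<le> 1 / 2 * (1 + val \<phi>)" using a by simp
  next
    obtain b where b: "sat_fraction b \<phi> = val \<phi>" using val_attained .
    obtain a where "num_sat a (split_from 0 \<phi>) = length \<phi> + num_sat b \<phi>"
      using num_sat_split_from_attained[OF len] .
    then have "sat_fraction a (split_from 0 \<phi>) = 1 / 2 * (1 + sat_fraction b \<phi>)"
      using pos by (simp add: frac field_simps)
    then show "1 / 2 * (1 + val \<phi>) \<le> val (split_from 0 \<phi>)"
      using b sat_fraction_le_val[of a "split_from 0 \<phi>"] by simp
  qed
qed

section \<open>The Turing machine\<close>

text \<open>Tape \<open>2\<close> is the counter. An entry \<open>(q', m, s, d, n)\<close> for state \<open>q\<close>, input symbol \<open>a\<close> and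
  counter symbol \<open>e\<close> means: go to state \<open>q'\<close>, move the input head by \<open>m\<close>, append \<open>s\<close> to the
  output, write \<open>d\<close> on the counter and move its head by \<open>n\<close>. State \<open>0\<close> awaits a constraint, states
  \<open>1\<close> and \<open>8\<close> write the fresh variable, \<open>4, 6, 11, 13\<close> copy the bits of the four old variables, and
  \<open>14\<close> is the halting state. The symbol \<open>0\<close> that is appended in the halting step is the blank.\<close>

definition table :: "nat \<Rightarrow> nat \<Rightarrow> nat \<Rightarrow> nat \<times> move \<times> nat \<times> nat \<times> move" where
  "table q a e =
    (if q = 0 then (if a = 0 then (14, MStay, 0, e, MStay) else (1, MStay, 3, 1, MStay))
     else if q = 1 then (if e = 1 then (1, MStay, 1, e, MRight) else (2, MStay, 2, e, MLeft))
     else if q = 2 then (3, MRight, a, e, MStay)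
     else if q = 3 then (4, MStay, 2, e, MStay)
     else if q = 4 then (if a < 3 then (4, MRight, a, e, MStay) else (5, MRight, a, e, MStay))
     else if q = 5 then (6, MStay, 2, e, MStay)
     else if q = 6 then (if a < 3 then (6, MRight, a, e, MStay) else (7, MStay, 5, e, MStay))
     else if q = 7 then (8, MStay, 4, e, MStay)
     else if q = 8 then (if e = 1 then (8, MStay, 1, e, MLeft) else (9, MStay, 2, e, MStay))
     else if q = 9 then (10, MRight, a, e, MStay)
     else if q = 10 then (11, MStay, 2, e, MStay)
     else if q = 11 then (if a < 3 then (11, MRight, a, e, MStay) else (12, MRight, a, e, MStay))
     else if q = 12 then (13, MStay, 2, e, MStay)
     else (if a < 3 then (13, MRight, a, e, MStay) else (0, MRight, a, e, MStay)))"

definition split_tm :: tm where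
  "split_tm = \<lparr>num_tapes = 3, num_states = 14, num_symbols = 6,
     trans = (\<lambda>q ss. case table q (ss ! 0) (ss ! 2) of (q', m, s, d, n) \<Rightarrow>
       (q', [(ss ! 0, m), (s, MRight), (d, n)]))\<rparr>"

lemma wf_split_tm: "wf_tm split_tm"
proof -
  have "fst (trans split_tm q ss) \<le> 14 \<and> length (snd (trans split_tm q ss)) = 3 \<and>
      fst ` set (snd (trans split_tm q ss)) \<subseteq> {..<6}"
    if ss: "length ss = 3" "set ss \<subseteq> {..<6}" for q ss
  proof -
    obtain a o' e where "ss = [a, o', e]"
      using ss(1) by (auto simp: numeral_eq_Suc length_Suc_conv)
    with ss(2) show ?thesis by (simp add: split_tm_def table_def)
  qed
  then show ?thesis unfolding wf_tm_def by (simp add: split_tm_def)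
qed

text \<open>The counter grows to the left, so that its head, which walks right while the positive
  occurrence of a fresh variable is written and left while the negative one is, ends up on the cell
  where the next mark goes.\<close>

definition marks :: "nat \<Rightarrow> int \<Rightarrow> nat" where
  "marks k i = (if - int k < i \<and> i \<le> 0 then 1 else 0)"

text \<open>\<open>u\<close> is the part of the input already read, \<open>r\<close> the rest.\<close>

definition conf :: "nat \<Rightarrow> nat list \<Rightarrow> nat list \<Rightarrow> nat list \<Rightarrow> nat \<Rightarrow> int \<Rightarrow> config" where
  "conf q u r v k h =
     (q, [(contents (u @ r), int (length u)), (contents v, int (length v)), (marks k, h)])"

section \<open>Runs of the machine with exact step counts\<close>

definition reach :: "nat \<Rightarrow> config \<Rightarrow> config \<Rightarrow> bool" where
  "reach t C D \<longleftrightarrow> (step split_tm ^^ t) C = D"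

lemma reach_0: "reach 0 C C"
  by (simp add: reach_def)

lemma reach_trans [trans]: "reach s C D \<Longrightarrow> reach t D E \<Longrightarrow> reach (s + t) C E"
  unfolding reach_def by (subst add.commute) (auto simp: funpow_add)

lemma contents_snoc: "(contents v)(int (length v) := s) = contents (v @ [s])"
  by (auto simp: contents_def fun_eq_iff nth_append)

lemma contents_snoc_blank: "contents (v @ [0]) = contents v"
  by (auto simp: contents_def fun_eq_iff nth_append)

lemma contents_at_length: "contents (u @ r) (int (length u)) = (case r of [] \<Rightarrow> 0 | a # _ \<Rightarrow> a)"
  by (auto simp: contents_def split: list.splits)

lemma step_conf:
  assumes "q < 14" "table q (case r of [] \<Rightarrow> 0 | a # _ \<Rightarrow> a) (marks k h) = (q', m, s, d, n)"
  shows "step split_tm (conf q u r v k h) =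
    (q', [(contents (u @ r), move_head m (int (length u))),
          (contents (v @ [s]), int (length (v @ [s]))), ((marks k)(h := d), move_head n h)])"
proof -
  \<comment> \<open>The machine rewrites the symbol it has just read, so the input tape never
    changes; past the end this is the blank.\<close>
  have "(contents (u @ r))(int (length u) := (case r of [] \<Rightarrow> 0 | a # _ \<Rightarrow> a)) = contents (u @ r)"
    by (metis contents_at_length fun_upd_triv)
  then show ?thesis
    using assms by (simp add: step_def conf_def split_tm_def contents_at_length contents_snoc)
qed

text \<open>The equation for \<open>k'\<close> covers both an unchanged counter and the step that
  adds a mark.\<close>

lemma reach_stay:
  assumes "q < 14" "table q (case r of [] \<Rightarrow> 0 | a # _ \<Rightarrow> a) (marks k h) = (q', MStay, s, d, n)"
    and "(marks k)(h := d) = marks k'"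
  shows "reach 1 (conf q u r v k h) (conf q' u r (v @ [s]) k' (move_head n h))"
  using assms by (simp add: reach_def step_conf) (simp add: conf_def)

lemma reach_copy:
  assumes "q < 14" "table q a (marks k h) = (q', MRight, a, marks k h, MStay)"
  shows "reach 1 (conf q u (a # r) v k h) (conf q' (u @ [a]) r (v @ [a]) k h)"
  using assms by (simp add: reach_def step_conf) (simp add: conf_def add.commute)

lemma reach_bits:
  assumes "q \<in> {4, 6, 11, 13}" "\<forall>x\<in>set w. x < 3"
  shows "reach (length w) (conf q u (w @ r) v k h) (conf q (u @ w) r (v @ w) k h)"
  using assms(2)
proof (induction w arbitrary: u v)
  case (Cons a w)
  have "reach 1 (conf q u (a # w @ r) v k h) (conf q (u @ [a]) (w @ r) (v @ [a]) k h)"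
    using assms(1) Cons.prems by (intro reach_copy) (auto simp: table_def)
  also have "reach (length w) \<dots> (conf q ((u @ [a]) @ w) r ((v @ [a]) @ w) k h)"
    using Cons.prems by (intro Cons.IH) simp
  finally show ?case by simp
qed (simp add: reach_0)

text \<open>Here \<open>j\<close> is the number of marks still to be read. Cell \<open>1\<close> is
  the first blank; there the closing bit is written and the head steps back to \<open>0\<close>,
  ready for the leftward pass.\<close>

lemma reach_marks_right:
  assumes "j \<le> k"
  shows "reach (Suc j) (conf 1 u r v k (1 - int j)) (conf 2 u r (v @ replicate j 1 @ [2]) k 0)"
  using assms
proof (induction j arbitrary: v)
  case 0
  show ?case
    using reach_stay[of 1 r k 1 2 2 0 MLeft k u v] by (simp add: table_def marks_def fun_eq_iff)
next
  case (Suc j)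
  have "reach 1 (conf 1 u r v k (1 - int (Suc j)))
      (conf 1 u r (v @ [1]) k (move_head MRight (1 - int (Suc j))))"
    using Suc.prems by (intro reach_stay[where d = 1]) (auto simp: table_def marks_def fun_eq_iff)
  also have "reach (Suc j) \<dots> (conf 2 u r ((v @ [1]) @ replicate j 1 @ [2]) k 0)"
    using Suc.IH[of "v @ [1]"] Suc.prems by simp
  finally show ?case by simp
qed

text \<open>The head stops at \<open>- int k\<close>, the blank just beyond the leftmost mark, and
  stays there.\<close>

lemma reach_marks_left:
  assumes "j \<le> k"
  shows "reach (Suc j) (conf 8 u r v k (int j - int k))
    (conf 9 u r (v @ replicate j 1 @ [2]) k (- int k))"
  using assms
proof (induction j arbitrary: v)
  case 0
  show ?case
    using reach_stay[of 8 r k "- int k" 9 2 0 MStay k u v]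
    by (simp add: table_def marks_def fun_eq_iff)
next
  case (Suc j)
  have "reach 1 (conf 8 u r v k (int (Suc j) - int k))
      (conf 8 u r (v @ [1]) k (move_head MLeft (int (Suc j) - int k)))"
    using Suc.prems by (intro reach_stay[where d = 1]) (auto simp: table_def marks_def fun_eq_iff)
  also have "reach (Suc j) \<dots> (conf 9 u r ((v @ [1]) @ replicate j 1 @ [2]) k (- int k))"
    using Suc.IH[of "v @ [1]"] Suc.prems by simp
  finally show ?case by simp
qed

section \<open>Translation of literals and constraints\<close>

lemma enc_nat_odd: "enc_nat (2 * x + 1) = 2 # enc_nat x"
  by (subst enc_nat.simps) simp

lemma enc_nat_power_2: "enc_nat (2 ^ n) = replicate n 1 @ [2]"
proof (induction n)
  case 0
  show ?case by (simp add: enc_nat.simps)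
next
  case (Suc n)
  then show ?case by (subst enc_nat.simps) simp
qed

lemma enc_lit_conv:
  obtains s w where "s \<in> {3, 4}" "\<forall>x\<in>set w. x < 3"
    "enc_lit l = s # w" "enc_lit (lift_lit l) = s # 2 # w"
proof (cases l)
  case (Pos x)
  then show ?thesis
    using that[of 3 "enc_nat x"] enc_nat_less enc_nat_odd[of x] by (simp del: mult_Suc_right)
next
  case (Neg x)
  then show ?thesis
    using that[of 4 "enc_nat x"] enc_nat_less enc_nat_odd[of x] by (simp del: mult_Suc_right)
qed

text \<open>State \<open>q\<close> copies the sign, \<open>q + 1\<close> inserts the new lowest bit
  of \<open>2 * x + 1\<close>, and \<open>q + 2\<close> copies the old bits. States \<open>4\<close>
  and \<open>11\<close> do double duty: the sign that ends the bits of one literal starts the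
  next.\<close>

lemma reach_lit:
  assumes q: "q \<in> {2, 4, 9, 11}"
  shows "reach (length (enc_lit l) + 1) (conf q u (enc_lit l @ r) v k h)
    (conf (q + 2) (u @ enc_lit l) r (v @ enc_lit (lift_lit l)) k h)"
proof -
  obtain s w where l: "s \<in> {3, 4}" "\<forall>x\<in>set w. x < 3"
    "enc_lit l = s # w" "enc_lit (lift_lit l) = s # 2 # w" using enc_lit_conv .
  have "reach 1 (conf q u (s # w @ r) v k h) (conf (q + 1) (u @ [s]) (w @ r) (v @ [s]) k h)"
    using q l(1) by (intro reach_copy) (auto simp: table_def)
  also have "reach 1 \<dots> (conf (q + 2) (u @ [s]) (w @ r) ((v @ [s]) @ [2]) k (move_head MStay h))"
    using q by (intro reach_stay[where d = "marks k h"]) (auto simp: table_def)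
  also have "reach (length w) \<dots>
      (conf (q + 2) ((u @ [s]) @ w) r (((v @ [s]) @ [2]) @ w) k (move_head MStay h))"
    using q l(2) by (intro reach_bits) auto
  finally show ?thesis by (simp add: l(3,4))
qed

lemma hd_enc_lit: "\<exists>s w. s \<ge> 3 \<and> enc_lit l = s # w"
  by (cases l) auto

lemma reach_constraint:
  assumes "length c = 4"
  shows "reach (length (enc_constraint c) + 2 * k + 11)
    (conf 0 u (enc_constraint c @ r) v k (- int k))
    (conf 0 (u @ enc_constraint c) r (v @ enc_formula (split_from k [c])) (Suc k) (- int (Suc k)))"
proof -
  obtain l1 l2 l3 l4 where c: "c = [l1, l2, l3, l4]" using assms by (auto simp: length_4_conv)
  define K where "K = Suc k"
  let ?r4 = "5 # r"
  let ?r3 = "enc_lit l4 @ ?r4"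
  let ?r2 = "enc_lit l3 @ ?r3"
  let ?r1 = "enc_lit l2 @ ?r2"
  let ?r0 = "enc_lit l1 @ ?r1"
  let ?u1 = "u @ enc_lit l1"
  let ?u2 = "?u1 @ enc_lit l2"
  let ?u3 = "?u2 @ enc_lit l3"
  let ?u4 = "?u3 @ enc_lit l4"
  let ?v0 = "(v @ [3]) @ replicate K 1 @ [2]"
  let ?v2 = "(?v0 @ enc_lit (lift_lit l1)) @ enc_lit (lift_lit l2)"
  let ?w0 = "((?v2 @ [5]) @ [4]) @ replicate K 1 @ [2]"
  let ?w2 = "(?w0 @ enc_lit (lift_lit l3)) @ enc_lit (lift_lit l4)"
  have "reach 1 (conf 0 u ?r0 v k (- int k)) (conf 1 u ?r0 (v @ [3]) K (move_head MStay (- int k)))"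
    using hd_enc_lit[of l1]
    by (intro reach_stay[where d = 1]) (auto simp: table_def marks_def fun_eq_iff K_def)
  also have "move_head MStay (- int k) = 1 - int K" by (simp add: K_def)
  also have "reach (Suc K) (conf 1 u ?r0 (v @ [3]) K (1 - int K)) (conf 2 u ?r0 ?v0 K 0)"
    by (rule reach_marks_right) simp
  also have "reach (length (enc_lit l1) + 1) \<dots>
      (conf (2 + 2) ?u1 ?r1 (?v0 @ enc_lit (lift_lit l1)) K 0)"
    by (rule reach_lit) simp
  also have "2 + 2 = (4::nat)" by simp
  also have "reach (length (enc_lit l2) + 1)
      (conf 4 ?u1 ?r1 (?v0 @ enc_lit (lift_lit l1)) K 0) (conf (4 + 2) ?u2 ?r2 ?v2 K 0)"
    by (rule reach_lit) simp
  \<comment> \<open>The sign of the third literal ends the bits of the second but is not consumed: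
    first \<open>5\<close> closes the first new constraint and \<open>4\<close> opens the negated
    fresh literal.\<close>
  also have "reach 1 \<dots> (conf 7 ?u2 ?r2 (?v2 @ [5]) K (move_head MStay 0))"
    using hd_enc_lit[of l3] by (intro reach_stay[where d = "marks K 0"]) (auto simp: table_def)
  also have "reach 1 \<dots> (conf 8 ?u2 ?r2 ((?v2 @ [5]) @ [4]) K (move_head MStay (move_head MStay 0)))"
    by (intro reach_stay[where d = "marks K 0"]) (auto simp: table_def)
  also have "move_head MStay (move_head MStay 0) = int K - int K" by simp
  also have "reach (Suc K) (conf 8 ?u2 ?r2 ((?v2 @ [5]) @ [4]) K (int K - int K))
      (conf 9 ?u2 ?r2 ?w0 K (- int K))"
    by (rule reach_marks_left) simp
  also have "reach (length (enc_lit l3) + 1) \<dots>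
      (conf (9 + 2) ?u3 ?r3 (?w0 @ enc_lit (lift_lit l3)) K (- int K))"
    by (rule reach_lit) simp
  also have "9 + 2 = (11::nat)" by simp
  also have "reach (length (enc_lit l4) + 1)
      (conf 11 ?u3 ?r3 (?w0 @ enc_lit (lift_lit l3)) K (- int K))
      (conf (11 + 2) ?u4 ?r4 ?w2 K (- int K))"
    by (rule reach_lit) simp
  also have "reach 1 \<dots> (conf 0 (?u4 @ [5]) r (?w2 @ [5]) K (- int K))"
    by (rule reach_copy) (auto simp: table_def)
  finally have "reach (length (enc_constraint c) + 2 * k + 11) (conf 0 u ?r0 v k (- int k))
      (conf 0 (?u4 @ [5]) r (?w2 @ [5]) K (- int K))"
    \<comment> \<open>Two counter passes of \<open>Suc K\<close> steps, one extra step per literal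
      and four single steps, besides the copied literals, add up to the claimed time.\<close>
    by (rule back_subst[where P = "\<lambda>t. reach t _ _"]) (simp add: c enc_constraint_def K_def)
  then show ?thesis
    using enc_nat_power_2[of K]
    by (simp add: c enc_constraint_def enc_formula_def K_def del: replicate_Suc power_Suc)
qed

section \<open>The whole run and its quadratic time bound\<close>

lemma enc_formula_Cons: "enc_formula (c # \<phi>) = enc_constraint c @ enc_formula \<phi>"
  by (simp add: enc_formula_def)

text \<open>The counter never exceeds \<open>k + length \<phi>\<close>, which bounds the overhead of
  every constraint uniformly.\<close>

lemma reach_formula:
  assumes "\<forall>c\<in>set \<phi>. length c = 4"
  shows "\<exists>t \<le> length (enc_formula \<phi>) + length \<phi> * (2 * (k + length \<phi>) + 11).
    reach t (conf 0 u (enc_formula \<phi>) v k (- int k))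
      (conf 0 (u @ enc_formula \<phi>) [] (v @ enc_formula (split_from k \<phi>))
        (k + length \<phi>) (- int (k + length \<phi>)))"
  using assms
proof (induction \<phi> arbitrary: u v k)
  case Nil
  show ?case using reach_0 by (auto simp: enc_formula_def)
next
  case (Cons c \<phi>)
  let ?u = "u @ enc_constraint c" and ?v = "v @ enc_formula (split_from k [c])"
  have v: "?v @ enc_formula (split_from (Suc k) \<phi>) = v @ enc_formula (split_from k (c # \<phi>))"
    by (simp add: enc_formula_def)
  obtain t where
    t: "t \<le> length (enc_formula \<phi>) + length \<phi> * (2 * (Suc k + length \<phi>) + 11)"
    and tail: "reach t (conf 0 ?u (enc_formula \<phi>) ?v (Suc k) (- int (Suc k)))
      (conf 0 (?u @ enc_formula \<phi>) [] (?v @ enc_formula (split_from (Suc k) \<phi>))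
        (Suc k + length \<phi>) (- int (Suc k + length \<phi>)))"
    using Cons.IH Cons.prems by (metis list.set_intros(2))
  have "reach (length (enc_constraint c) + 2 * k + 11)
      (conf 0 u (enc_formula (c # \<phi>)) v k (- int k))
      (conf 0 ?u (enc_formula \<phi>) ?v (Suc k) (- int (Suc k)))"
    using Cons.prems unfolding enc_formula_Cons by (intro reach_constraint) simp
  from reach_trans[OF this tail[unfolded v]]
  have "reach (length (enc_constraint c) + 2 * k + 11 + t)
      (conf 0 u (enc_formula (c # \<phi>)) v k (- int k))
      (conf 0 (u @ enc_formula (c # \<phi>)) [] (v @ enc_formula (split_from k (c # \<phi>)))
        (k + length (c # \<phi>)) (- int (k + length (c # \<phi>))))"
    by (simp add: enc_formula_Cons del: split_from.simps)
  moreover have "length (enc_constraint c) + 2 * k + 11 + t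
      \<le> length (enc_formula (c # \<phi>)) + length (c # \<phi>) * (2 * (k + length (c # \<phi>)) + 11)"
    using t by (simp add: enc_formula_Cons)
  ultimately show ?case by blast
qed

text \<open>Each constraint contributes its end marker \<open>5\<close>. This turns a time bound in
  the number of constraints into one in the input length.\<close>

lemma length_le_enc_formula: "length \<phi> \<le> length (enc_formula \<phi>)"
  by (induction \<phi>) (auto simp: enc_formula_Cons enc_constraint_def enc_formula_def)

lemma outputs_within_split_tm:
  assumes "\<forall>c\<in>set \<phi>. length c = 4"
  shows "outputs_within split_tm (enc_formula \<phi>) (enc_formula (split_from 0 \<phi>))
    (poly [:1, 12, 2:] (length (enc_formula \<phi>)))"
proof -
  let ?v = "enc_formula (split_from 0 \<phi>)" and ?m = "length \<phi>" and ?n = "length (enc_formula \<phi>)"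
  obtain t where t: "t \<le> ?n + ?m * (2 * (0 + ?m) + 11)"
    and "reach t (conf 0 [] (enc_formula \<phi>) [] 0 (- int 0))
      (conf 0 ([] @ enc_formula \<phi>) [] ([] @ ?v) (0 + ?m) (- int (0 + ?m)))"
    using reach_formula[OF assms, where k = 0 and u = "[]" and v = "[]"] by blast
  moreover have "init_config split_tm (enc_formula \<phi>) = conf 0 [] (enc_formula \<phi>) [] 0 (- int 0)"
    by (auto simp: init_config_def conf_def split_tm_def numeral_eq_Suc marks_def contents_def fun_eq_iff)
  ultimately have "(step split_tm ^^ t) (init_config split_tm (enc_formula \<phi>)) =
      conf 0 (enc_formula \<phi>) [] ?v ?m (- int ?m)"
    by (simp add: reach_def)
  then have "(step split_tm ^^ Suc t) (init_config split_tm (enc_formula \<phi>)) =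
      (14, [(contents (enc_formula \<phi>), int ?n), (contents ?v, int (length (?v @ [0]))),
        (marks ?m, - int ?m)])"
    by (simp add: step_conf table_def contents_snoc_blank)
  \<comment> \<open>The polynomial is \<open>1 + n + n * (2 * n + 11)\<close> for input length
    \<open>n\<close>, where the \<open>1\<close> is the halting step.\<close>
  moreover have "Suc t \<le> poly [:1, 12, 2:] ?n"
  proof -
    have "?m * (2 * ?m + 11) \<le> ?n * (2 * ?n + 11)"
      using length_le_enc_formula[of \<phi>] by (intro mult_le_mono) auto
    with t show ?thesis by (simp add: algebra_simps)
  qed
  ultimately show ?thesis
    unfolding outputs_within_def by (intro exI[of _ "Suc t"]) (simp add: split_tm_def del: funpow.simps)
qed

lemma set_enc_formula: "set (enc_formula \<phi>) \<subseteq> {0<..<6}"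
proof -
  have "set (enc_nat n) \<subseteq> {0<..<6}" for n
    by (induction n rule: enc_nat.induct) (subst enc_nat.simps, auto)
  then have "set (enc_lit l) \<subseteq> {0<..<6}" for l
    by (cases l) auto
  then show ?thesis by (simp add: enc_formula_def enc_constraint_def UN_subset_iff)
qed

theorem theoremA3:
  "\<exists>f :: formula \<Rightarrow> formula.
     polytime_on (nae_formulas 4) enc_formula enc_formula f \<and>
     (\<forall>\<phi>\<in>nae_formulas 4. f \<phi> \<in> nae_formulas 3 \<and> val (f \<phi>) = 1 / 2 * (1 + val \<phi>))"
proof (intro exI[of _ "split_from 0"] conjI ballI)
  show "polytime_on (nae_formulas 4) enc_formula enc_formula (split_from 0)"
    unfolding polytime_on_def
  proof (intro exI[of _ split_tm] exI[of _ "[:1, 12, 2:]"] conjI ballI wf_split_tm)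
    show "outputs_within split_tm (enc_formula \<phi>) (enc_formula (split_from 0 \<phi>))
        (poly [:1, 12, 2:] (length (enc_formula \<phi>)))" if "\<phi> \<in> nae_formulas 4" for \<phi>
      using that by (intro outputs_within_split_tm) (simp add: nae_formulas_def)
  qed (use set_enc_formula in \<open>simp_all add: split_tm_def\<close>)
qed (simp_all add: split_from_in_nae_formulas val_split_from)

end
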